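(* Let $(a_n)_{n\ge1}$ be a sequence of real or complex numbers and let $(X_n)_{n\ge1}$ be a sequence of real or complex Gaussian identically distributed random variables with zero mean. If $$\sum_{n,m=1}^\infty|a_n|\,|a_m|\,|\mathbb{E}(X_n\overline{X_m})|<\infty,$$ then the series $\sum_{n=1}^\infty a_nX_n$ converges almost surely.
   Context: The random variables $X_n$ are defined on a common probability space, $\mathbb{E}$ denotes expectation and the bar denotes complex conjugation. No independence of the $X_n$ is assumed.
   Formalization: "Gaussian" is taken to mean that the sequence is jointly Gaussian (all finite real linear combinations of real and imaginary parts are Gaussian); with only Gaussian marginals the claim fails, e.g. for a rearranged Walsh system multiplied by an independent |g|, with g standard normal. *)

theory Defs
  imports "HOL-Probability.Probability"
begin

text \<open>Point masses count as (degenerate) Gaussians, so that the imaginary part of a real-valued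
  variable, or a linear combination of variance zero, is not excluded.\<close>

definition gaussian_rv :: "'a measure \<Rightarrow> ('a \<Rightarrow> real) \<Rightarrow> bool" where
  "gaussian_rv M Y \<longleftrightarrow> Y \<in> borel_measurable M \<and>
     ((\<exists>\<mu> \<sigma>. \<sigma> > 0 \<and> distributed M lborel Y (normal_density \<mu> \<sigma>)) \<or>
      (\<exists>\<mu>. AE \<omega> in M. Y \<omega> = \<mu>))"

text \<open>A family of complex random variables is Gaussian if the real and imaginary parts of its
  members are jointly Gaussian: every finite real linear combination of them is Gaussian.
  No circular symmetry is required; thus both the circularly symmetric case and the real-valued
  case (see the lemma below) are included.\<close>

definition gaussian_family :: "'a measure \<Rightarrow> 'i set \<Rightarrow> ('i \<Rightarrow> 'a \<Rightarrow> complex) \<Rightarrow> bool" where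
  "gaussian_family M I X \<longleftrightarrow> (\<forall>i\<in>I. X i \<in> borel_measurable M) \<and>
     (\<forall>J u v. finite J \<and> J \<subseteq> I \<longrightarrow>
        gaussian_rv M (\<lambda>\<omega>. \<Sum>i\<in>J. u i * Re (X i \<omega>) + v i * Im (X i \<omega>)))"

lemma gaussian_family_of_real_iff:
  "gaussian_family M I (\<lambda>i \<omega>. complex_of_real (Y i \<omega>)) \<longleftrightarrow>
     (\<forall>J u. finite J \<and> J \<subseteq> I \<longrightarrow> gaussian_rv M (\<lambda>\<omega>. \<Sum>i\<in>J. u i * Y i \<omega>))"
    (is "?L \<longleftrightarrow> ?R")
proof
  assume ?L
  then show ?R by (simp add: gaussian_family_def)
next
  assume R: ?R
  have "(\<lambda>\<omega>. complex_of_real (Y i \<omega>)) \<in> borel_measurable M" if "i \<in> I" for i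
  proof -
    have "gaussian_rv M (\<lambda>\<omega>. \<Sum>j\<in>{i}. 1 * Y j \<omega>)"
      using R[rule_format, of "{i}" "\<lambda>_. 1"] that by simp
    then have "Y i \<in> borel_measurable M" by (simp add: gaussian_rv_def)
    then show ?thesis by measurable
  qed
  with R show ?L by (simp add: gaussian_family_def)
qed

end

theory Submission
  imports Defs
begin

text \<open>
  Let \<open>S N\<close> be the partial sums and let \<open>t N\<close> be the sum of
  \<open>\<bar>a n\<bar> \<bar>a m\<bar> \<bar>E (X n * cnj (X m))\<bar>\<close> over \<open>1 \<le> n \<le> N\<close> and \<^emph>\<open>all\<close> \<open>m \<ge> 1\<close>. Letting \<open>m\<close> run over
  everything makes \<open>t j - t i\<close> the contribution of the rows \<open>n\<close> with \<open>i < n \<le> j\<close>, so that this bound is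
  additive over consecutive blocks, and it still dominates \<open>E \<bar>S j - S i\<bar>\<^sup>2\<close>, which only involves
  the square \<open>i < n, m \<le> j\<close>. The function \<open>t\<close> is increasing and bounded because the double series
  converges.

  For a general sequence, second moments bounded by an additive function do not give almost sure
  convergence (a logarithmic factor is lost, as for orthogonal series). This is where
  normality enters: the fourth moment of a centred Gaussian variable is controlled by
  the square of its second moment, hence \<open>E \<bar>S j - S i\<bar>\<^sup>4 \<le> 6 (t j - t i)\<^sup>2\<close>
  (\<open>complex_gaussian_fourth_moment_le\<close>). The exponent 2 on the right exceeds 1, and a halving
  argument then bounds the fourth moment of the \<^emph>\<open>maximal\<close> increment by a constant multiple of
  the same quantity (\<open>nn_integral_SUP_increments_le\<close>). Since \<open>t\<close> converges, the maximal
  increments after time \<open>m\<close> tend to zero as \<open>m\<close> grows, and almost every path is a Cauchy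
  sequence (\<open>AE_convergent_of_increments\<close>).

  For complex variables the pseudo-covariances \<open>E (X n * X m)\<close> can be large although
  the covariances are small. The real and the imaginary part of an increment are under control
  all the same: their variances add up to \<open>E \<bar>S j - S i\<bar>\<^sup>2\<close>, and each is a real Gaussian variable by joint normality.
\<close>

section \<open>A maximal inequality from fourth moments of increments\<close>

text \<open>The coefficient of \<open>y ^ 4\<close> has to be smaller than 2 for the halving argument below; the price
  is the large coefficient of \<open>x ^ 4\<close>, which is harmless.\<close>

lemma power4_add_le:
  fixes x y :: real
  shows "(x + y) ^ 4 \<le> 729 * x ^ 4 + 3/2 * y ^ 4"
proof -
  have square: "(p + q)\<^sup>2 \<le> 9 * p\<^sup>2 + 9/8 * q\<^sup>2" for p q :: real
  proof -
    have "9 * p\<^sup>2 + 9/8 * q\<^sup>2 - (p + q)\<^sup>2 = (8 * p - q)\<^sup>2 / 8"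
      by (simp add: power2_eq_square field_simps)
    then show ?thesis by (metis diff_ge_0_iff_ge divide_nonneg_nonneg zero_le_numeral zero_le_power2)
  qed
  have "(x + y) ^ 4 = ((x + y)\<^sup>2)\<^sup>2" by simp
  also have "\<dots> \<le> (9 * x\<^sup>2 + 9/8 * y\<^sup>2)\<^sup>2"
    by (rule power_mono[OF square]) simp
  also have "\<dots> \<le> 9 * (9 * x\<^sup>2)\<^sup>2 + 9/8 * (9/8 * y\<^sup>2)\<^sup>2"
    by (rule square)
  also have "\<dots> = 729 * x ^ 4 + 729/512 * y ^ 4"
    by (simp add: power_mult_distrib power_divide)
  also have "\<dots> \<le> 729 * x ^ 4 + 3/2 * y ^ 4"
    by (intro add_left_mono mult_right_mono) auto
  finally show ?thesis .
qed

text \<open>The inequality is proved by induction on the length of the block \<open>{m..n}\<close>. Split the block at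
  the first index \<open>h\<close> where \<open>t\<close> has gained half of the total increment \<open>T = t n - t m\<close>. On both
  \<open>{m..h-1}\<close> and \<open>{h..n}\<close> the function \<open>t\<close> gains at most \<open>T / 2\<close>. By the triangle inequality
  through \<open>S h\<close>, the maximal increment over \<open>{m..n}\<close> is at most the single increment
  \<open>S h - S m\<close> plus the larger of the two maximal increments over the halves. Because of the square
  of \<open>T\<close>, each half contributes only a quarter of the bound for the whole, together one half;
  multiplied by the factor \<open>3/2\<close> from \<open>power4_add_le\<close> this leaves a quarter of the bound to absorb
  the single increment: \<open>729 + 3/2 * 2000 \<le> 4000\<close>.\<close>

lemma nn_integral_SUP_increments_le:
  fixes S :: "nat \<Rightarrow> 'a \<Rightarrow> 'b :: {second_countable_topology, banach}"
    and t :: "nat \<Rightarrow> real"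
  assumes meas [measurable]: "\<And>k. S k \<in> borel_measurable M"
    and "mono t" and "C \<ge> 0"
    and increments: "\<And>i j. i \<le> j \<Longrightarrow>
      (\<integral>\<^sup>+\<omega>. ennreal (norm (S j \<omega> - S i \<omega>) ^ 4) \<partial>M) \<le> ennreal (C * (t j - t i)\<^sup>2)"
    and "m \<le> n"
  shows "(\<integral>\<^sup>+\<omega>. (SUP k\<in>{m..n}. ennreal (norm (S k \<omega> - S m \<omega>) ^ 4)) \<partial>M)
    \<le> ennreal (4000 * C * (t n - t m)\<^sup>2)"
  using \<open>m \<le> n\<close>
proof (induction "n - m" arbitrary: m n rule: less_induct)
  case less
  define sup4 where
    "sup4 m n \<omega> = (SUP k\<in>{m..n}. ennreal (norm (S k \<omega> - S m \<omega>) ^ 4))" for m n \<omega>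
  have [measurable]: "sup4 i j \<in> borel_measurable M" for i j
    unfolding sup4_def by measurable
  show ?case
  proof (cases "m = n")
    case True
    then show ?thesis by simp
  next
    case False
    with \<open>m \<le> n\<close> have "m < n" by simp
    define T where "T = t n - t m"
    have "T \<ge> 0" using \<open>mono t\<close> \<open>m \<le> n\<close> by (simp add: T_def monoD)
    define h where "h = (LEAST h. m < h \<and> t h - t m \<ge> T / 2)"
    have h_ex: "m < n \<and> t n - t m \<ge> T / 2"
      using \<open>m < n\<close> \<open>T \<ge> 0\<close> by (simp add: T_def)
    have h: "m < h" "t h - t m \<ge> T / 2"
      using LeastI[of "\<lambda>h. m < h \<and> t h - t m \<ge> T / 2", OF h_ex] by (auto simp: h_def)
    have "h \<le> n"
      unfolding h_def using Least_le[of "\<lambda>h. m < h \<and> t h - t m \<ge> T / 2", OF h_ex] .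
    \<comment> \<open>Either the left block is a single point, or minimality of \<open>h\<close> applies to its end.\<close>
    have left: "t (h - 1) - t m \<le> T / 2"
    proof (cases "h - 1 = m")
      case True
      then show ?thesis using \<open>T \<ge> 0\<close> by simp
    next
      case False
      have "\<not> (m < h - 1 \<and> t (h - 1) - t m \<ge> T / 2)"
        using not_less_Least[of "h - 1" "\<lambda>h. m < h \<and> t h - t m \<ge> T / 2", folded h_def] h(1) by simp
      with False h(1) show ?thesis by auto
    qed
    have right: "t n - t h \<le> T / 2"
      using h(2) by (simp add: T_def field_simps)
    have half: "4000 * C * (t j - t i)\<^sup>2 \<le> 1000 * C * T\<^sup>2"
      if "t j - t i \<le> T / 2" "i \<le> j" for i j
    proof -
      have "(t j - t i)\<^sup>2 \<le> (T / 2)\<^sup>2"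
        using that \<open>mono t\<close> by (intro power_mono) (auto simp: monoD)
      then have "4000 * C * (t j - t i)\<^sup>2 \<le> 4000 * C * (T / 2)\<^sup>2"
        using \<open>C \<ge> 0\<close> by (intro mult_left_mono) auto
      also have "\<dots> = 1000 * C * T\<^sup>2" by (simp add: power_divide)
      finally show ?thesis .
    qed
    have A: "(\<integral>\<^sup>+\<omega>. sup4 m (h - 1) \<omega> \<partial>M) \<le> ennreal (1000 * C * T\<^sup>2)"
      using less.hyps[of "h - 1" m] h(1) \<open>h \<le> n\<close> half[OF left]
      unfolding sup4_def by (force intro: order_trans ennreal_leI)
    have B: "(\<integral>\<^sup>+\<omega>. sup4 h n \<omega> \<partial>M) \<le> ennreal (1000 * C * T\<^sup>2)"
      using less.hyps[of n h] h(1) \<open>h \<le> n\<close> half[OF right]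
      unfolding sup4_def by (force intro: order_trans ennreal_leI)
    have "(\<integral>\<^sup>+\<omega>. ennreal (norm (S h \<omega> - S m \<omega>) ^ 4) \<partial>M) \<le> ennreal (C * (t h - t m)\<^sup>2)"
      using h(1) by (intro increments) simp
    also have "\<dots> \<le> ennreal (C * T\<^sup>2)"
      using \<open>C \<ge> 0\<close> \<open>mono t\<close> h(1) \<open>h \<le> n\<close>
      by (intro ennreal_leI mult_left_mono power_mono) (auto simp: T_def monoD)
    finally have D: "(\<integral>\<^sup>+\<omega>. ennreal (norm (S h \<omega> - S m \<omega>) ^ 4) \<partial>M) \<le> ennreal (C * T\<^sup>2)" .
    have pointwise: "sup4 m n \<omega> \<le> ennreal 729 * ennreal (norm (S h \<omega> - S m \<omega>) ^ 4)
        + ennreal (3/2) * (sup4 m (h - 1) \<omega> + sup4 h n \<omega>)" (is "_ \<le> ?rhs") for \<omega>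
      unfolding sup4_def[of m n]
    proof (rule SUP_least)
      fix k assume k: "k \<in> {m..n}"
      show "ennreal (norm (S k \<omega> - S m \<omega>) ^ 4) \<le> ?rhs"
      proof (cases "k \<le> h - 1")
        case True
        have "ennreal (norm (S k \<omega> - S m \<omega>) ^ 4) \<le> sup4 m (h - 1) \<omega>"
          unfolding sup4_def using True k by (intro SUP_upper) auto
        also have "\<dots> = ennreal 1 * sup4 m (h - 1) \<omega>" by simp
        also have "\<dots> \<le> ennreal (3/2) * (sup4 m (h - 1) \<omega> + sup4 h n \<omega>)"
          by (intro mult_mono ennreal_leI) auto
        also have "\<dots> \<le> ?rhs" by simp
        finally show ?thesis .
      next
        case False
        have "norm (S k \<omega> - S m \<omega>) \<le> norm (S h \<omega> - S m \<omega>) + norm (S k \<omega> - S h \<omega>)"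
          using norm_triangle_ineq[of "S h \<omega> - S m \<omega>" "S k \<omega> - S h \<omega>"] by simp
        then have "norm (S k \<omega> - S m \<omega>) ^ 4
            \<le> (norm (S h \<omega> - S m \<omega>) + norm (S k \<omega> - S h \<omega>)) ^ 4"
          by (intro power_mono) auto
        also have "\<dots> \<le> 729 * norm (S h \<omega> - S m \<omega>) ^ 4 + 3/2 * norm (S k \<omega> - S h \<omega>) ^ 4"
          by (rule power4_add_le)
        finally have "ennreal (norm (S k \<omega> - S m \<omega>) ^ 4) \<le>
            ennreal (729 * norm (S h \<omega> - S m \<omega>) ^ 4 + 3/2 * norm (S k \<omega> - S h \<omega>) ^ 4)"
          by (rule ennreal_leI)
        also have "\<dots> = ennreal 729 * ennreal (norm (S h \<omega> - S m \<omega>) ^ 4)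
            + ennreal (3/2) * ennreal (norm (S k \<omega> - S h \<omega>) ^ 4)"
          using ennreal_mult'[of 729] ennreal_mult'[of "3/2"] by (subst ennreal_plus) auto
        also have "ennreal (norm (S k \<omega> - S h \<omega>) ^ 4) \<le> sup4 h n \<omega>"
          unfolding sup4_def using False k by (intro SUP_upper) auto
        also have "\<dots> \<le> sup4 m (h - 1) \<omega> + sup4 h n \<omega>" by simp
        finally show ?thesis by (simp add: mult_left_mono add_left_mono)
      qed
    qed
    have "(\<integral>\<^sup>+\<omega>. sup4 m n \<omega> \<partial>M)
        \<le> (\<integral>\<^sup>+\<omega>. ennreal 729 * ennreal (norm (S h \<omega> - S m \<omega>) ^ 4)
            + ennreal (3/2) * (sup4 m (h - 1) \<omega> + sup4 h n \<omega>) \<partial>M)"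
      by (intro nn_integral_mono pointwise)
    also have "\<dots> = ennreal 729 * (\<integral>\<^sup>+\<omega>. ennreal (norm (S h \<omega> - S m \<omega>) ^ 4) \<partial>M)
        + ennreal (3/2) * ((\<integral>\<^sup>+\<omega>. sup4 m (h - 1) \<omega> \<partial>M) + (\<integral>\<^sup>+\<omega>. sup4 h n \<omega> \<partial>M))"
      by (simp add: nn_integral_add nn_integral_cmult)
    also have "\<dots> \<le> ennreal 729 * ennreal (C * T\<^sup>2)
        + ennreal (3/2) * (ennreal (1000 * C * T\<^sup>2) + ennreal (1000 * C * T\<^sup>2))"
      by (intro add_mono mult_left_mono A B D) auto
    also have "\<dots> = ennreal (729 * (C * T\<^sup>2) + 3/2 * (1000 * C * T\<^sup>2 + 1000 * C * T\<^sup>2))"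
      using \<open>C \<ge> 0\<close> by (simp only: ennreal_mult ennreal_plus zero_le_power2
            zero_le_mult_iff zero_le_numeral zero_le_divide_iff add_nonneg_nonneg simp_thms)
    also have "\<dots> \<le> ennreal (4000 * C * T\<^sup>2)"
      using \<open>C \<ge> 0\<close> by (intro ennreal_leI) simp
    finally show ?thesis by (simp add: sup4_def T_def)
  qed
qed

text \<open>The maximal inequality bounds the expected fourth power of the largest increment after time
  \<open>m\<close> by a multiple of \<open>(l - t m)\<^sup>2\<close>, where \<open>l\<close> is the limit of \<open>t\<close>. The infimum over \<open>m\<close> of these
  largest increments therefore has expectation zero and vanishes almost everywhere, which is the
  Cauchy criterion for the paths.\<close>

lemma AE_convergent_of_increments:
  fixes S :: "nat \<Rightarrow> 'a \<Rightarrow> 'b :: {second_countable_topology, banach}"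
    and t :: "nat \<Rightarrow> real"
  assumes meas [measurable]: "\<And>k. S k \<in> borel_measurable M"
    and "mono t" and bounded: "\<And>n. t n \<le> b" and "C \<ge> 0"
    and increments: "\<And>i j. i \<le> j \<Longrightarrow>
      (\<integral>\<^sup>+\<omega>. ennreal (norm (S j \<omega> - S i \<omega>) ^ 4) \<partial>M) \<le> ennreal (C * (t j - t i)\<^sup>2)"
  shows "AE \<omega> in M. convergent (\<lambda>n. S n \<omega>)"
proof -
  define Y where "Y m n \<omega> = (SUP k\<in>{m..n}. ennreal (norm (S k \<omega> - S m \<omega>) ^ 4))" for m n \<omega>
  have [measurable]: "Y i j \<in> borel_measurable M" for i j
    unfolding Y_def by measurable
  obtain l where l: "t \<longlonglongrightarrow> l" "\<And>n. t n \<le> l"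
    using incseq_convergent[of t b] \<open>mono t\<close> bounded by blast
  have tail: "(\<integral>\<^sup>+\<omega>. (SUP n. Y m n \<omega>) \<partial>M) \<le> ennreal (4000 * C * (l - t m)\<^sup>2)" for m
  proof -
    have "(\<integral>\<^sup>+\<omega>. (SUP n. Y m n \<omega>) \<partial>M) = (SUP n. \<integral>\<^sup>+\<omega>. Y m n \<omega> \<partial>M)"
      by (intro nn_integral_monotone_convergence_SUP)
        (auto simp: incseq_def le_fun_def Y_def intro!: SUP_subset_mono)
    also have "\<dots> \<le> ennreal (4000 * C * (l - t m)\<^sup>2)"
    proof (rule SUP_least)
      fix n
      show "(\<integral>\<^sup>+\<omega>. Y m n \<omega> \<partial>M) \<le> ennreal (4000 * C * (l - t m)\<^sup>2)"
      proof (cases "m \<le> n")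
        case True
        have "(\<integral>\<^sup>+\<omega>. Y m n \<omega> \<partial>M) \<le> ennreal (4000 * C * (t n - t m)\<^sup>2)"
          unfolding Y_def
          by (rule nn_integral_SUP_increments_le[OF meas \<open>mono t\<close> \<open>C \<ge> 0\<close> increments True])
        also have "\<dots> \<le> ennreal (4000 * C * (l - t m)\<^sup>2)"
          using True \<open>mono t\<close> \<open>C \<ge> 0\<close> l(2)
          by (intro ennreal_leI mult_left_mono power_mono) (auto simp: monoD)
        finally show ?thesis .
      next
        \<comment> \<open>An empty supremum of extended nonnegative reals is \<open>0\<close>.\<close>
        case False
        then show ?thesis by (simp add: Y_def bot_ennreal)
      qed
    qed
    finally show ?thesis .
  qed
  have "(\<integral>\<^sup>+\<omega>. (INF m. SUP n. Y m n \<omega>) \<partial>M) \<le> 0"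
  proof (rule LIMSEQ_le_const)
    have "(\<lambda>m. 4000 * C * (l - t m)\<^sup>2) \<longlonglongrightarrow> 4000 * C * (l - l)\<^sup>2"
      by (intro tendsto_intros l)
    then show "(\<lambda>m. ennreal (4000 * C * (l - t m)\<^sup>2)) \<longlonglongrightarrow> 0"
      using tendsto_ennrealI by fastforce
    have "(\<integral>\<^sup>+\<omega>. (INF m. SUP n. Y m n \<omega>) \<partial>M) \<le> ennreal (4000 * C * (l - t m)\<^sup>2)" for m
      by (rule order_trans[OF nn_integral_mono tail]) (auto intro: INF_lower)
    then show "\<exists>N. \<forall>m\<ge>N. (\<integral>\<^sup>+\<omega>. (INF m. SUP n. Y m n \<omega>) \<partial>M) \<le> ennreal (4000 * C * (l - t m)\<^sup>2)"
      by blast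
  qed
  then have "AE \<omega> in M. (INF m. SUP n. Y m n \<omega>) = 0"
    by (subst (asm) le_zero_eq, subst (asm) nn_integral_0_iff_AE) auto
  then show ?thesis
  proof eventually_elim
    case (elim \<omega>)
    have "Cauchy (\<lambda>n. S n \<omega>)"
    proof (rule CauchyI)
      fix e :: real assume "e > 0"
      then have "(INF m. SUP n. Y m n \<omega>) < ennreal ((e / 2) ^ 4)"
        using elim by simp
      then obtain m where m: "(SUP n. Y m n \<omega>) < ennreal ((e / 2) ^ 4)"
        unfolding INF_less_iff by blast
      have near: "norm (S k \<omega> - S m \<omega>) < e / 2" if "m \<le> k" for k
      proof -
        have "ennreal (norm (S k \<omega> - S m \<omega>) ^ 4) \<le> Y m k \<omega>"
          unfolding Y_def using that by (intro SUP_upper) auto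
        also have "\<dots> \<le> (SUP n. Y m n \<omega>)" by (rule SUP_upper) simp
        also note m
        finally have "norm (S k \<omega> - S m \<omega>) ^ 4 < (e / 2) ^ 4"
          by (simp add: ennreal_less_iff)
        then show ?thesis by (rule power_less_imp_less_base) (use \<open>e > 0\<close> in simp)
      qed
      show "\<exists>N. \<forall>j\<ge>N. \<forall>k\<ge>N. norm (S j \<omega> - S k \<omega>) < e"
      proof (intro exI allI impI)
        fix j k assume "m \<le> j" "m \<le> k"
        then show "norm (S j \<omega> - S k \<omega>) < e"
          using norm_triangle_ineq4[of "S j \<omega> - S m \<omega>" "S k \<omega> - S m \<omega>"] near[of j] near[of k]
          by simp
      qed
    qed
    then show ?case by (rule Cauchy_convergent)
  qed
qed

section \<open>Fourth moments of Gaussian variables\<close>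

text \<open>The moments of a normal density are known about its mean; the raw second moment is recovered by expanding
  \<open>x\<^sup>2 = (x - \<mu>)\<^sup>2 + 2 * \<mu> * (x - \<mu>) + \<mu>\<^sup>2\<close>.\<close>

lemma gaussian_rv_integrable_power2:
  assumes "prob_space M" and "gaussian_rv M Y"
  shows "integrable M (\<lambda>\<omega>. (Y \<omega>)\<^sup>2)"
proof -
  interpret prob_space M by fact
  have meas [measurable]: "Y \<in> borel_measurable M"
    using assms(2) by (simp add: gaussian_rv_def)
  consider (normal) \<mu> \<sigma> where "\<sigma> > 0" "distributed M lborel Y (normal_density \<mu> \<sigma>)"
    | (const) \<mu> where "AE \<omega> in M. Y \<omega> = \<mu>"
    using assms(2) by (auto simp: gaussian_rv_def)
  then show ?thesis
  proof cases
    case normal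
    have "integrable lborel (\<lambda>x. normal_density \<mu> \<sigma> x * (x - \<mu>) ^ k)" for k
      by (rule integrable_normal_moment[OF normal(1)])
    from this[of 2] this[of 1] this[of 0]
    have "integrable lborel (\<lambda>x. normal_density \<mu> \<sigma> x * (x - \<mu>) ^ 2
        + 2 * \<mu> * (normal_density \<mu> \<sigma> x * (x - \<mu>) ^ 1)
        + \<mu>\<^sup>2 * (normal_density \<mu> \<sigma> x * (x - \<mu>) ^ 0))"
      by (intro Bochner_Integration.integrable_add integrable_mult_right)
    also have "(\<lambda>x. normal_density \<mu> \<sigma> x * (x - \<mu>) ^ 2
        + 2 * \<mu> * (normal_density \<mu> \<sigma> x * (x - \<mu>) ^ 1)
        + \<mu>\<^sup>2 * (normal_density \<mu> \<sigma> x * (x - \<mu>) ^ 0)) = (\<lambda>x. normal_density \<mu> \<sigma> x * x\<^sup>2)"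
      by (rule ext) (simp add: power2_eq_square algebra_simps)
    finally show ?thesis
      using distributed_integrable[OF normal(2), of "\<lambda>x. x\<^sup>2"] by simp
  next
    case const
    then have "AE \<omega> in M. (Y \<omega>)\<^sup>2 = \<mu>\<^sup>2" by eventually_elim simp
    then show ?thesis
      by (subst integrable_cong_AE[where g = "\<lambda>_. \<mu>\<^sup>2"]) auto
  qed
qed

text \<open>Normality enters the convergence proof through this identity. Point masses satisfy it as well, since mean zero forces them to sit at \<open>0\<close>.\<close>

lemma gaussian_rv_fourth_moment:
  assumes "prob_space M" and "gaussian_rv M Y" and mean: "(LINT \<omega>|M. Y \<omega>) = 0"
  shows "(\<integral>\<^sup>+\<omega>. ennreal (Y \<omega> ^ 4) \<partial>M) = ennreal (3 * (LINT \<omega>|M. (Y \<omega>)\<^sup>2)\<^sup>2)"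
proof -
  interpret prob_space M by fact
  have meas [measurable]: "Y \<in> borel_measurable M"
    using assms(2) by (simp add: gaussian_rv_def)
  consider (normal) \<mu> \<sigma> where "\<sigma> > 0" "distributed M lborel Y (normal_density \<mu> \<sigma>)"
    | (const) \<mu> where "AE \<omega> in M. Y \<omega> = \<mu>"
    using assms(2) by (auto simp: gaussian_rv_def)
  then show ?thesis
  proof cases
    case normal
    have "\<mu> = 0"
      using normal_distributed_expectation[OF normal(1,2)] mean by simp
    have moment: "has_bochner_integral lborel (\<lambda>x. normal_density 0 \<sigma> x * x ^ (2 * k))
        (fact (2 * k) / ((2 / \<sigma>\<^sup>2) ^ k * fact k))" for k
      using normal_moment_even[OF normal(1), of 0 k] by simp
    have dist: "distributed M lborel Y (normal_density 0 \<sigma>)"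
      using normal(2) \<open>\<mu> = 0\<close> by simp
    have "(LINT \<omega>|M. (Y \<omega>)\<^sup>2) = \<sigma>\<^sup>2"
      using distributed_integral[OF dist, of "\<lambda>x. x\<^sup>2"]
        has_bochner_integral_integral_eq[OF moment[of 1]] by simp
    moreover have "(LINT \<omega>|M. Y \<omega> ^ 4) = 3 * (\<sigma>\<^sup>2)\<^sup>2"
      using distributed_integral[OF dist, of "\<lambda>x. x ^ 4"]
        has_bochner_integral_integral_eq[OF moment[of 2]] normal(1)
      by (simp add: fact_numeral power_divide)
    moreover have "integrable M (\<lambda>\<omega>. Y \<omega> ^ 4)"
      using distributed_integrable[OF dist, of "\<lambda>x. x ^ 4"]
        integrable.intros[OF moment[of 2]] by simp
    ultimately show ?thesis
      by (subst nn_integral_eq_integral) auto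
  next
    case const
    have "(LINT \<omega>|M. Y \<omega>) = (LINT \<omega>|M. \<mu>)"
      using const by (intro integral_cong_AE) auto
    then have "\<mu> = 0" using mean by (simp add: prob_space)
    have "(\<integral>\<^sup>+\<omega>. ennreal (Y \<omega> ^ 4) \<partial>M) = (\<integral>\<^sup>+\<omega>. 0 \<partial>M)"
      using const \<open>\<mu> = 0\<close> by (intro nn_integral_cong_AE) (auto elim: eventually_mono)
    moreover have "(LINT \<omega>|M. (Y \<omega>)\<^sup>2) = (LINT \<omega>|M. 0)"
      using const \<open>\<mu> = 0\<close> by (intro integral_cong_AE) (auto elim: eventually_mono)
    ultimately show ?thesis by simp
  qed
qed

text \<open>The inequality \<open>(x + y)\<^sup>2 \<le> 2 * x\<^sup>2 + 2 * y\<^sup>2\<close> separates the real from the imaginary part,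
  however these are correlated, and their second moments
  are each at most, and together equal to, the second moment of the norm.\<close>

lemma complex_gaussian_fourth_moment_le:
  fixes D :: "'a \<Rightarrow> complex"
  assumes "prob_space M" and re: "gaussian_rv M (\<lambda>\<omega>. Re (D \<omega>))" and im: "gaussian_rv M (\<lambda>\<omega>. Im (D \<omega>))"
    and "integrable M D" and mean: "(LINT \<omega>|M. D \<omega>) = 0"
  shows "(\<integral>\<^sup>+\<omega>. ennreal (norm (D \<omega>) ^ 4) \<partial>M) \<le> ennreal (6 * (LINT \<omega>|M. (norm (D \<omega>))\<^sup>2)\<^sup>2)"
proof -
  have [measurable]: "(\<lambda>\<omega>. Re (D \<omega>)) \<in> borel_measurable M" "(\<lambda>\<omega>. Im (D \<omega>)) \<in> borel_measurable M"
    using re im by (auto simp: gaussian_rv_def)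
  define r where "r = (LINT \<omega>|M. (Re (D \<omega>))\<^sup>2)"
  define s where "s = (LINT \<omega>|M. (Im (D \<omega>))\<^sup>2)"
  have [simp]: "r \<ge> 0" "s \<ge> 0" by (simp_all add: r_def s_def)
  have norm2: "(LINT \<omega>|M. (norm (D \<omega>))\<^sup>2) = r + s"
    unfolding cmod_power2 r_def s_def
    using re im \<open>prob_space M\<close>
    by (intro Bochner_Integration.integral_add gaussian_rv_integrable_power2)
  have "norm z ^ 4 \<le> 2 * Re z ^ 4 + 2 * Im z ^ 4" for z :: complex
  proof -
    have "norm z ^ 4 = ((norm z)\<^sup>2)\<^sup>2" by simp
    also have "\<dots> = ((Re z)\<^sup>2 + (Im z)\<^sup>2)\<^sup>2" by (simp only: cmod_power2)
    also have "\<dots> \<le> 2 * ((Re z)\<^sup>2)\<^sup>2 + 2 * ((Im z)\<^sup>2)\<^sup>2"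
      using sum_squares_bound[of "(Re z)\<^sup>2" "(Im z)\<^sup>2"] by (simp add: power2_sum)
    finally show ?thesis by simp
  qed
  then have "(\<integral>\<^sup>+\<omega>. ennreal (norm (D \<omega>) ^ 4) \<partial>M)
      \<le> (\<integral>\<^sup>+\<omega>. ennreal (2 * Re (D \<omega>) ^ 4 + 2 * Im (D \<omega>) ^ 4) \<partial>M)"
    by (intro nn_integral_mono ennreal_leI)
  also have "\<dots> = 2 * (\<integral>\<^sup>+\<omega>. ennreal (Re (D \<omega>) ^ 4) \<partial>M) + 2 * (\<integral>\<^sup>+\<omega>. ennreal (Im (D \<omega>) ^ 4) \<partial>M)"
    by (simp add: ennreal_mult nn_integral_add nn_integral_cmult)
  also have "\<dots> = 2 * ennreal (3 * r\<^sup>2) + 2 * ennreal (3 * s\<^sup>2)"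
    unfolding r_def s_def using assms
    by (subst (1 2) gaussian_rv_fourth_moment) auto
  also have "\<dots> = ennreal (2 * (3 * r\<^sup>2) + 2 * (3 * s\<^sup>2))"
    by (simp add: ennreal_mult)
  also have "\<dots> \<le> ennreal (6 * (r + s)\<^sup>2)"
    by (intro ennreal_leI) (simp add: power2_sum)
  finally show ?thesis by (simp add: norm2)
qed

section \<open>Sums with absolutely summable covariances\<close>

text \<open>The second moment of the sum expands exactly into the covariances weighted by
  \<open>a n * cnj (a m)\<close>; all cancellation between them is given away here.\<close>

lemma integral_norm_sum_square_le:
  fixes Z :: "nat \<Rightarrow> 'a \<Rightarrow> complex"
  assumes "finite J" and int: "\<And>n m. n \<in> J \<Longrightarrow> m \<in> J \<Longrightarrow> integrable M (\<lambda>\<omega>. Z n \<omega> * cnj (Z m \<omega>))"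
  shows "(LINT \<omega>|M. (norm (\<Sum>n\<in>J. a n * Z n \<omega>))\<^sup>2) \<le>
    (\<Sum>(n, m)\<in>J \<times> J. norm (a n) * norm (a m) * norm (LINT \<omega>|M. Z n \<omega> * cnj (Z m \<omega>)))"
proof -
  have expand: "complex_of_real ((norm (\<Sum>n\<in>J. a n * Z n \<omega>))\<^sup>2)
      = (\<Sum>(n, m)\<in>J \<times> J. a n * cnj (a m) * (Z n \<omega> * cnj (Z m \<omega>)))" for \<omega>
    by (simp add: complex_norm_square sum_product sum.cartesian_product[symmetric] mult_ac del: of_real_power)
  have "complex_of_real (LINT \<omega>|M. (norm (\<Sum>n\<in>J. a n * Z n \<omega>))\<^sup>2)
      = (LINT \<omega>|M. (\<Sum>(n, m)\<in>J \<times> J. a n * cnj (a m) * (Z n \<omega> * cnj (Z m \<omega>))))"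
    by (simp only: integral_complex_of_real[symmetric] expand)
  also have "\<dots> = (\<Sum>(n, m)\<in>J \<times> J. a n * cnj (a m) * (LINT \<omega>|M. Z n \<omega> * cnj (Z m \<omega>)))"
    unfolding case_prod_beta using int
    by (subst Bochner_Integration.integral_sum) auto
  finally have "norm (complex_of_real (LINT \<omega>|M. (norm (\<Sum>n\<in>J. a n * Z n \<omega>))\<^sup>2))
      \<le> (\<Sum>(n, m)\<in>J \<times> J. norm (a n * cnj (a m) * (LINT \<omega>|M. Z n \<omega> * cnj (Z m \<omega>))))"
    unfolding case_prod_beta by (simp only: norm_sum)
  then show ?thesis
    by (simp add: norm_mult abs_le_iff)
qed

theorem theorem2:
  fixes M :: "'a measure"
    and a :: "nat \<Rightarrow> complex"
    and X :: "nat \<Rightarrow> 'a \<Rightarrow> complex"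
  assumes "prob_space M"
    and gaussian: "gaussian_family M {1..} X"
    and identically_distributed:
      "\<And>n m. n \<ge> 1 \<Longrightarrow> m \<ge> 1 \<Longrightarrow> distr M borel (X n) = distr M borel (X m)"
    and zero_mean: "\<And>n. n \<ge> 1 \<Longrightarrow> (LINT \<omega>|M. X n \<omega>) = 0"
    and summable_covariances:
      "(\<lambda>(n, m). norm (a n) * norm (a m) * norm (LINT \<omega>|M. X n \<omega> * cnj (X m \<omega>)))
         summable_on ({1..} \<times> {1..})"
  shows "AE \<omega> in M. convergent (\<lambda>N. \<Sum>n=1..N. a n * X n \<omega>)"
proof -
  interpret prob_space M by fact
  have meas: "X n \<in> borel_measurable M" if "n \<ge> 1" for n
    using gaussian that by (auto simp: gaussian_family_def)
  have combination: "gaussian_rv M (\<lambda>\<omega>. \<Sum>i\<in>J. u i * Re (X i \<omega>) + v i * Im (X i \<omega>))"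
    if "finite J" "J \<subseteq> {1..}" for J u v
    using gaussian that by (auto simp: gaussian_family_def)
  have square: "integrable M (\<lambda>\<omega>. (norm (X n \<omega>))\<^sup>2)" if "n \<ge> 1" for n
  proof -
    have "integrable M (\<lambda>\<omega>. (Re (X n \<omega>))\<^sup>2)" "integrable M (\<lambda>\<omega>. (Im (X n \<omega>))\<^sup>2)"
      using combination[of "{n}" "\<lambda>_. 1" "\<lambda>_. 0"] combination[of "{n}" "\<lambda>_. 0" "\<lambda>_. 1"] that
      by (auto intro!: gaussian_rv_integrable_power2[OF \<open>prob_space M\<close>])
    then show ?thesis by (simp add: cmod_power2)
  qed
  have product: "integrable M (\<lambda>\<omega>. X n \<omega> * cnj (X m \<omega>))" if "n \<ge> 1" "m \<ge> 1" for n m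
  proof (rule Bochner_Integration.integrable_bound)
    show "integrable M (\<lambda>\<omega>. (norm (X n \<omega>))\<^sup>2 + (norm (X m \<omega>))\<^sup>2)"
      using that by (intro Bochner_Integration.integrable_add square)
    show "(\<lambda>\<omega>. X n \<omega> * cnj (X m \<omega>)) \<in> borel_measurable M"
      using meas[OF that(1)] measurable_compose[OF meas[OF that(2)]
          borel_measurable_continuous_onI[OF continuous_on_cnj[OF continuous_on_id]]]
      by (intro borel_measurable_times) auto
    have "x * y \<le> \<bar>x\<^sup>2 + y\<^sup>2\<bar>" if "x \<ge> 0" "y \<ge> 0" for x y :: real
    proof -
      have "x * y \<ge> 0" using that by simp
      with sum_squares_bound[of x y] have "x * y \<le> x\<^sup>2 + y\<^sup>2" by linarith
      then show ?thesis by simp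
    qed
    then show "AE \<omega> in M. norm (X n \<omega> * cnj (X m \<omega>)) \<le> norm ((norm (X n \<omega>))\<^sup>2 + (norm (X m \<omega>))\<^sup>2)"
      by (simp add: norm_mult)
  qed
  have integrable: "integrable M (X n)" if "n \<ge> 1" for n
  proof (rule Bochner_Integration.integrable_bound)
    show "integrable M (\<lambda>\<omega>. 1 + (norm (X n \<omega>))\<^sup>2)"
      using that by (intro Bochner_Integration.integrable_add square) auto
    have "x \<le> \<bar>1 + x\<^sup>2\<bar>" if "x \<ge> 0" for x :: real
      using sum_squares_bound[of 1 x] that by simp
    then show "AE \<omega> in M. norm (X n \<omega>) \<le> norm (1 + (norm (X n \<omega>))\<^sup>2)"
      by simp
  qed (rule meas[OF that])

  define f where
    "f = (\<lambda>(n, m). norm (a n) * norm (a m) * norm (LINT \<omega>|M. X n \<omega> * cnj (X m \<omega>)))"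
  have f_nonneg: "f p \<ge> 0" for p by (simp add: f_def split: prod.split)
  have f_summable: "f summable_on A" if "A \<subseteq> {1..} \<times> {1..}" for A
    using summable_covariances that unfolding f_def by (rule summable_on_subset_banach)
  \<comment> \<open>The second index is not cut off at \<open>N\<close>: this is what makes the increments of \<open>t\<close> additive.\<close>
  define t where "t N = infsum f ({1..N} \<times> {1..})" for N
  have t_diff: "t j - t i = infsum f ({i+1..j} \<times> {1..})" if "i \<le> j" for i j
  proof -
    have "{1..j} \<times> {1::nat..} = {1..i} \<times> {1..} \<union> {i+1..j} \<times> {1..}"
      using that by auto
    moreover have "infsum f ({1..i} \<times> {1..} \<union> {i+1..j} \<times> {1..})
        = t i + infsum f ({i+1..j} \<times> {1..})"
      unfolding t_def by (intro infsum_Un_disjoint f_summable) auto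
    ultimately have "t j = t i + infsum f ({i+1..j} \<times> {1..})"
      by (simp add: t_def)
    then show ?thesis by simp
  qed
  have "mono t"
  proof (rule monoI)
    fix i j :: nat assume "i \<le> j"
    then show "t i \<le> t j"
      using t_diff[of i j] infsum_nonneg[of "{i+1..j} \<times> {1..}" f] f_nonneg by simp
  qed
  have t_bounded: "t N \<le> infsum f ({1..} \<times> {1..})" for N
    unfolding t_def by (intro infsum_mono2 f_summable f_nonneg) auto
  have square_le: "(\<Sum>p\<in>{i+1..j} \<times> {i+1..j}. f p) \<le> t j - t i" if "i \<le> j" for i j
    unfolding t_diff[OF that]
    by (intro finite_sum_le_infsum f_summable f_nonneg) auto

  define S where "S N \<omega> = (\<Sum>n=1..N. a n * X n \<omega>)" for N \<omega>
  have S_diff: "S j \<omega> - S i \<omega> = (\<Sum>n=i+1..j. a n * X n \<omega>)" if "i \<le> j" for i j \<omega>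
    unfolding S_def using that sum.ub_add_nat[of 1 i "\<lambda>n. a n * X n \<omega>" "j - i"] by simp
  have "AE \<omega> in M. convergent (\<lambda>N. S N \<omega>)"
  proof (rule AE_convergent_of_increments[where C = 6])
    show "S N \<in> borel_measurable M" for N
      unfolding S_def using meas by (intro borel_measurable_sum borel_measurable_times) auto
    show "mono t" by fact
    show "t N \<le> infsum f ({1..} \<times> {1..})" for N by (rule t_bounded)
    fix i j :: nat assume "i \<le> j"
    define J where "J = {i+1..j}"
    define D where "D \<omega> = (\<Sum>n\<in>J. a n * X n \<omega>)" for \<omega>
    have J: "finite J" "J \<subseteq> {1..}" by (auto simp: J_def)
    \<comment> \<open>Complex coefficients mix the real and imaginary parts of the variables, so joint normality of
      all these parts is what makes \<open>Re D\<close> and \<open>Im D\<close> Gaussian.\<close>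
    have "(\<lambda>\<omega>. Re (D \<omega>)) = (\<lambda>\<omega>. \<Sum>n\<in>J. Re (a n) * Re (X n \<omega>) + - Im (a n) * Im (X n \<omega>))"
      by (simp add: D_def fun_eq_iff)
    then have re: "gaussian_rv M (\<lambda>\<omega>. Re (D \<omega>))"
      by (simp only: combination[OF J])
    have "(\<lambda>\<omega>. Im (D \<omega>)) = (\<lambda>\<omega>. \<Sum>n\<in>J. Im (a n) * Re (X n \<omega>) + Re (a n) * Im (X n \<omega>))"
      by (simp add: D_def fun_eq_iff add.commute)
    then have im: "gaussian_rv M (\<lambda>\<omega>. Im (D \<omega>))"
      by (simp only: combination[OF J])
    have "integrable M D" "(LINT \<omega>|M. D \<omega>) = 0"
      unfolding D_def using J integrable zero_mean by (auto simp: subset_iff)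
    then have "(\<integral>\<^sup>+\<omega>. ennreal (norm (D \<omega>) ^ 4) \<partial>M) \<le> ennreal (6 * (LINT \<omega>|M. (norm (D \<omega>))\<^sup>2)\<^sup>2)"
      by (intro complex_gaussian_fourth_moment_le re im \<open>prob_space M\<close>)
    also have "\<dots> \<le> ennreal (6 * (t j - t i)\<^sup>2)"
    proof (intro ennreal_leI mult_left_mono power_mono)
      have "(LINT \<omega>|M. (norm (D \<omega>))\<^sup>2) \<le> (\<Sum>p\<in>J \<times> J. f p)"
        unfolding D_def f_def using J by (intro integral_norm_sum_square_le product) auto
      also have "\<dots> \<le> t j - t i"
        unfolding J_def by (rule square_le[OF \<open>i \<le> j\<close>])
      finally show "(LINT \<omega>|M. (norm (D \<omega>))\<^sup>2) \<le> t j - t i" .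
    qed auto
    finally show "(\<integral>\<^sup>+\<omega>. ennreal (norm (S j \<omega> - S i \<omega>) ^ 4) \<partial>M) \<le> ennreal (6 * (t j - t i)\<^sup>2)"
      by (simp only: S_diff[OF \<open>i \<le> j\<close>] D_def J_def)
  qed simp
  then show ?thesis by (simp only: S_def)
qed

end
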